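(* Let $A$ and $B$ be Banach algebras with bounded approximate identities, and let $(E^{<},E^{>})$ be a Morita equivalence between them. Then $$\operatorname{Ind}_B^A:\mathcal I(B)\longrightarrow\mathcal I(A)$$ is an order isomorphism, with inverse $\operatorname{Ind}_A^B$. Hence it is an isomorphism of complete lattices of closed two-sided ideals.
   Context: All Banach spaces and Banach algebras are complex, and all Banach module actions are contractive. For a subset $S$ of a Banach space, $\overline{\operatorname{span}}\,S$ is its closed linear span. For sets $S,T$ a pairing symbol applied to $(S,T)$ denotes the set of all values on $S\times T$. A bounded approximate identity in a Banach algebra $A$ is a net $(u_\lambda)$ with $\sup_\lambda\|u_\lambda\|<\infty$ and $u_\lambda a\to a$, $au_\lambda\to a$ for every $a\in A$. A Morita equivalence $(E^{<},E^{>})$ between Banach algebras $A$ and $B$ consists of a Banach $B$-$A$-bimodule $E^{<}$, a Banach $A$-$B$-bimodule $E^{>}$, and continuous bilinear pairings $\langle\cdot,\cdot\rangle_B:E^{<}\times E^{>}\to B$ and ${}_A\langle\cdot,\cdot\rangle:E^{>}\times E^{<}\to A$ of norm at most one such that, for all $e^{<},f^{<}\in E^{<}$, $e^{>},f^{>}\in E^{>}$, $a\in A$, $b\in B$: (i) $\langle be^{<},e^{>}\rangle_B=b\langle e^{<},e^{>}\rangle_B$, $\langle e^{<},e^{>}b\rangle_B=\langle e^{<},e^{>}\rangle_Bb$, ${}_A\langle ae^{>},e^{<}\rangle=a\,{}_A\langle e^{>},e^{<}\rangle$, ${}_A\langle e^{>},e^{<}a\rangle={}_A\langle e^{>},e^{<}\rangle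 a$; (ii) $\langle e^{<}a,e^{>}\rangle_B=\langle e^{<},ae^{>}\rangle_B$, ${}_A\langle e^{>}b,e^{<}\rangle={}_A\langle e^{>},be^{<}\rangle$; (iii) $\langle e^{<},e^{>}\rangle_Bf^{<}=e^{<}\,{}_A\langle e^{>},f^{<}\rangle$, $e^{>}\langle f^{<},f^{>}\rangle_B={}_A\langle e^{>},f^{<}\rangle f^{>}$; (iv) both pairings are full: $\overline{\operatorname{span}}\,\langle E^{<},E^{>}\rangle_B=B$ and $\overline{\operatorname{span}}\,{}_A\langle E^{>},E^{<}\rangle=A$; (v) all four module actions are nondegenerate, i.e. the linear span of the module products is dense in the module. $\mathcal I(A)$ denotes the complete lattice of closed two-sided ideals of $A$, ordered by inclusion. For a closed two-sided ideal $I$ of $B$ put $E_I^{>}=\{\xi\in E^{>}:\langle\eta,\xi\rangle_B\in I\ \forall\eta\in E^{<}\}$ and $\operatorname{Ind}_B^A(I)=\overline{\operatorname{span}}\,{}_A\langle E_I^{>},E^{<}\rangle$. Symmetrically (interchanging $A$ and $B$, and $E^{>}$ and $E^{<}$), for a closed two-sided ideal $J$ of $A$ put $E_J^{<}=\{\eta\in E^{<}:{}_A\langle\xi,\eta\rangle\in J\ \forall\xi\in E^{>}\}$ and $\operatorname{Ind}_A^B(J)=\overline{\operatorname{span}}\,\langle E_J^{<},E^{>}\rangle_B$. *)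

theory Defs
  imports "HOL-Analysis.Analysis" "HOL-Algebra.Complete_Lattice"
begin

section \<open>Complex Banach spaces and Banach algebras\<close>

class scaleC =
  fixes scaleC :: "complex \<Rightarrow> 'a \<Rightarrow> 'a"  (infixr \<open>*\<^sub>C\<close> 75)

class complex_banach = scaleC + banach +
  assumes scaleC_add_right: "c *\<^sub>C (x + y) = c *\<^sub>C x + c *\<^sub>C y"
    and scaleC_add_left: "(c + d) *\<^sub>C x = c *\<^sub>C x + d *\<^sub>C x"
    and scaleC_scaleC: "c *\<^sub>C (d *\<^sub>C x) = (c * d) *\<^sub>C x"
    and scaleC_of_real: "complex_of_real r *\<^sub>C x = r *\<^sub>R x"
    and norm_scaleC: "norm (c *\<^sub>C x) = cmod c * norm x"

text \<open>Banach algebras are neither required to be unital nor to be nonzero;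
  submultiplicativity of the norm is inherited from \<^class>\<open>real_normed_algebra\<close>.\<close>

class complex_banach_algebra = complex_banach + real_normed_algebra +
  assumes mult_scaleC_left: "(c *\<^sub>C x) * y = c *\<^sub>C (x * y)"
    and mult_scaleC_right: "x * (c *\<^sub>C y) = c *\<^sub>C (x * y)"

global_interpretation complex_vector:
  vector_space "scaleC :: complex \<Rightarrow> 'a \<Rightarrow> 'a::complex_banach"
proof
  show "1 *\<^sub>C x = x" for x :: 'a
    using scaleC_of_real[of 1 x] by simp
qed (simp_all add: scaleC_add_right scaleC_add_left scaleC_scaleC)

definition closed_span :: "'a::complex_banach set \<Rightarrow> 'a set" where
  "closed_span S = closure (complex_vector.span S)"

section \<open>Bounded approximate identities\<close>

definition directed_on :: "'i set \<Rightarrow> ('i \<times> 'i) set \<Rightarrow> bool" where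
  "directed_on \<Lambda> r \<longleftrightarrow> preorder_on \<Lambda> r \<and> \<Lambda> \<noteq> {} \<and>
     (\<forall>i\<in>\<Lambda>. \<forall>j\<in>\<Lambda>. \<exists>k\<in>\<Lambda>. (i, k) \<in> r \<and> (j, k) \<in> r)"

text \<open>The filter generated by the tails of a directed set; convergence along it
  is convergence of nets.\<close>

definition tails :: "'i set \<Rightarrow> ('i \<times> 'i) set \<Rightarrow> 'i filter" where
  "tails \<Lambda> r = (INF i\<in>\<Lambda>. principal {j. (i, j) \<in> r})"

lemma eventually_tails:
  assumes "directed_on \<Lambda> r"
  shows "eventually P (tails \<Lambda> r) \<longleftrightarrow> (\<exists>i\<in>\<Lambda>. \<forall>j. (i, j) \<in> r \<longrightarrow> P j)"
proof -
  have "eventually P (tails \<Lambda> r)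
      \<longleftrightarrow> (\<exists>i\<in>\<Lambda>. eventually P (principal {j. (i, j) \<in> r}))"
    unfolding tails_def
  proof (rule eventually_INF_base)
    show "\<Lambda> \<noteq> {}"
      using assms by (simp add: directed_on_def)
    fix i j assume "i \<in> \<Lambda>" "j \<in> \<Lambda>"
    then obtain k where k: "k \<in> \<Lambda>" "(i, k) \<in> r" "(j, k) \<in> r"
      using assms unfolding directed_on_def by blast
    have "trans r"
      using assms by (simp add: directed_on_def preorder_on_def)
    then have "{l. (k, l) \<in> r} \<subseteq> {l. (i, l) \<in> r} \<inter> {l. (j, l) \<in> r}"
      using k by (auto dest: transD)
    then show "\<exists>x\<in>\<Lambda>. principal {l. (x, l) \<in> r}
        \<le> inf (principal {l. (i, l) \<in> r}) (principal {l. (j, l) \<in> r})"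
      using k(1) by auto
  qed
  then show ?thesis
    by (simp add: eventually_principal)
qed

definition bounded_approximate_identity ::
    "'i set \<Rightarrow> ('i \<times> 'i) set \<Rightarrow> ('i \<Rightarrow> 'a::complex_banach_algebra) \<Rightarrow> bool" where
  "bounded_approximate_identity \<Lambda> r u \<longleftrightarrow>
     directed_on \<Lambda> r \<and>
     (\<exists>C. \<forall>i\<in>\<Lambda>. norm (u i) \<le> C) \<and>
     (\<forall>a. ((\<lambda>i. u i * a) \<longlongrightarrow> a) (tails \<Lambda> r)) \<and>
     (\<forall>a. ((\<lambda>i. a * u i) \<longlongrightarrow> a) (tails \<Lambda> r))"

section \<open>Banach modules and Morita equivalences\<close>

text \<open>Complex bilinear maps of norm at most one.\<close>

locale contractive_bilinear =
  fixes f :: "'x::complex_banach \<Rightarrow> 'y::complex_banach \<Rightarrow> 'z::complex_banach"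
  assumes add_left: "f (x + x') y = f x y + f x' y"
    and add_right: "f x (y + y') = f x y + f x y'"
    and scaleC_left: "f (c *\<^sub>C x) y = c *\<^sub>C f x y"
    and scaleC_right: "f x (c *\<^sub>C y) = c *\<^sub>C f x y"
    and norm_le: "norm (f x y) \<le> norm x * norm y"

locale banach_left_module = contractive_bilinear act
  for act :: "'a::complex_banach_algebra \<Rightarrow> 'x::complex_banach \<Rightarrow> 'x" +
  assumes assoc: "act (a * a') x = act a (act a' x)"

locale banach_right_module = contractive_bilinear act
  for act :: "'x::complex_banach \<Rightarrow> 'a::complex_banach_algebra \<Rightarrow> 'x" +
  assumes assoc: "act x (a * a') = act (act x a) a'"

locale banach_bimodule =
    left: banach_left_module lact + right: banach_right_module ract
  for lact :: "'a::complex_banach_algebra \<Rightarrow> 'x::complex_banach \<Rightarrow> 'x"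
  and ract :: "'x \<Rightarrow> 'b::complex_banach_algebra \<Rightarrow> 'x" +
  assumes lact_ract: "ract (lact a x) b = lact a (ract x b)"

text \<open>The types \<open>'l\<close> and \<open>'r\<close> carry the bimodules $E^{<}$ (over $B$-$A$) and $E^{>}$
  (over $A$-$B$); \<open>lB\<close>, \<open>rA\<close> are the actions on \<open>'l\<close>, and \<open>lA\<close>, \<open>rB\<close> those on \<open>'r\<close>.
  The pairings with values in $B$ and $A$ are \<open>pB\<close> and \<open>pA\<close>.\<close>

locale morita_equivalence =
    El: banach_bimodule lB rA + Er: banach_bimodule lA rB +
    pB: contractive_bilinear pB + pA: contractive_bilinear pA
  for lB :: "'b::complex_banach_algebra \<Rightarrow> 'l::complex_banach \<Rightarrow> 'l"
  and rA :: "'l \<Rightarrow> 'a::complex_banach_algebra \<Rightarrow> 'l"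
  and lA :: "'a \<Rightarrow> 'r::complex_banach \<Rightarrow> 'r"
  and rB :: "'r \<Rightarrow> 'b \<Rightarrow> 'r"
  and pB :: "'l \<Rightarrow> 'r \<Rightarrow> 'b"
  and pA :: "'r \<Rightarrow> 'l \<Rightarrow> 'a" +
  assumes pB_left: "pB (lB b e) x = b * pB e x"
    and pB_right: "pB e (rB x b) = pB e x * b"
    and pA_left: "pA (lA a x) e = a * pA x e"
    and pA_right: "pA x (rA e a) = pA x e * a"
    and pB_balanced: "pB (rA e a) x = pB e (lA a x)"
    and pA_balanced: "pA (rB x b) e = pA x (lB b e)"
    and lB_pB: "lB (pB e x) f = rA e (pA x f)"
    and rB_pB: "rB x (pB f y) = lA (pA x f) y"
    and pB_full: "closed_span {pB e x | e x. True} = UNIV"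
    and pA_full: "closed_span {pA x e | x e. True} = UNIV"
    and lB_nondegenerate: "closed_span {lB b e | b e. True} = UNIV"
    and rA_nondegenerate: "closed_span {rA e a | e a. True} = UNIV"
    and lA_nondegenerate: "closed_span {lA a x | a x. True} = UNIV"
    and rB_nondegenerate: "closed_span {rB x b | x b. True} = UNIV"

section \<open>Closed ideals and induction\<close>

definition closed_ideal :: "'a::complex_banach_algebra set \<Rightarrow> bool" where
  "closed_ideal I \<longleftrightarrow> complex_vector.subspace I \<and> closed I \<and>
     (\<forall>a. \<forall>x\<in>I. a * x \<in> I \<and> x * a \<in> I)"

definition ideal_lattice :: "'a::complex_banach_algebra set gorder" where
  "ideal_lattice = \<lparr>carrier = {I. closed_ideal I}, eq = (=), le = (\<subseteq>)\<rparr>"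

text \<open>With the pairings of a Morita equivalence as above, \<open>ideal_submodule pB I\<close> is
  $E_I^{>}$ and \<open>ideal_submodule pA J\<close> is $E_J^{<}$. Accordingly \<open>Ind pB pA\<close> is
  induction from $B$ to $A$ and \<open>Ind pA pB\<close> is induction from $A$ to $B$.\<close>

definition ideal_submodule :: "('y \<Rightarrow> 'x \<Rightarrow> 'b) \<Rightarrow> 'b set \<Rightarrow> 'x set" where
  "ideal_submodule p I = {x. \<forall>y. p y x \<in> I}"

definition Ind ::
    "('y \<Rightarrow> 'x \<Rightarrow> 'b) \<Rightarrow> ('x \<Rightarrow> 'y \<Rightarrow> 'a::complex_banach) \<Rightarrow> 'b set \<Rightarrow> 'a set" where
  "Ind p q I = closed_span {q x y | x y. x \<in> ideal_submodule p I}"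

end

theory Submission
  imports Defs
begin

text \<open>The relation $\langle \eta', \xi_1\rangle_B\,\langle \eta, \xi\rangle_B
  = \langle \eta', {}_A\langle \xi_1, \eta\rangle\,\xi\rangle_B$ moves elements of an ideal through
  the pairings. For $J = \operatorname{Ind}_B^A(I)$ it puts
  $B\,\langle E_J^{<}, E^{>}\rangle_B$ inside $I$ and, because $I E^{<} \subseteq E_J^{<}$,
  it puts $I B$ inside $\operatorname{Ind}_A^B(J)$. The approximate identity of $B$ removes
  the factor $B$ from both inclusions, so that
  $\operatorname{Ind}_A^B(\operatorname{Ind}_B^A(I)) = I$. The hypotheses are symmetric in
  $A$ and $B$, and induction is monotone; mutually inverse monotone maps between complete lattices
  are isomorphisms.\<close>

section \<open>Closed complex subspaces and closed linear spans\<close>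

definition closed_csubspace :: "'a::complex_banach set \<Rightarrow> bool" where
  "closed_csubspace K \<longleftrightarrow> complex_vector.subspace K \<and> closed K"

lemma closed_ideal_closed_csubspace: "closed_ideal I \<Longrightarrow> closed_csubspace I"
  by (simp add: closed_ideal_def closed_csubspace_def)

lemma closed_span_minimal:
  assumes "S \<subseteq> K" "closed_csubspace K"
  shows "closed_span S \<subseteq> K"
  using assms unfolding closed_span_def closed_csubspace_def
  by (intro closure_minimal complex_vector.span_minimal) auto

lemma closed_span_superset: "S \<subseteq> closed_span S"
  unfolding closed_span_def
  using complex_vector.span_superset closure_subset by (rule order_trans)

lemma closed_span_mono: "S \<subseteq> T \<Longrightarrow> closed_span S \<subseteq> closed_span T"
  unfolding closed_span_def by (intro closure_mono complex_vector.span_mono)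

text \<open>Supplies the continuity by which complex multiples survive the passage to sequential
  limits in the closure of a span.\<close>

lemma bounded_linear_scaleC: "bounded_linear (\<lambda>x::'a::complex_banach. c *\<^sub>C x)"
proof (rule bounded_linear_intro)
  fix r :: real and x y :: 'a
  show "c *\<^sub>C (x + y) = c *\<^sub>C x + c *\<^sub>C y"
    by (rule scaleC_add_right)
  show "c *\<^sub>C r *\<^sub>R x = r *\<^sub>R c *\<^sub>C x"
    by (simp add: scaleC_scaleC mult.commute flip: scaleC_of_real)
  show "norm (c *\<^sub>C x) \<le> norm x * cmod c"
    by (simp add: norm_scaleC mult.commute)
qed

lemma closed_csubspace_closed_span: "closed_csubspace (closed_span S)"
proof -
  let ?V = "complex_vector.span S"
  have "x + y \<in> closure ?V" if x: "x \<in> closure ?V" and y: "y \<in> closure ?V" for x y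
  proof -
    obtain f where f: "\<And>n::nat. f n \<in> ?V" "f \<longlonglongrightarrow> x"
      using x unfolding closure_sequential by blast
    obtain g where g: "\<And>n::nat. g n \<in> ?V" "g \<longlonglongrightarrow> y"
      using y unfolding closure_sequential by blast
    have "(\<lambda>n. f n + g n) \<longlonglongrightarrow> x + y"
      using f(2) g(2) by (rule tendsto_add)
    moreover have "\<forall>n. f n + g n \<in> ?V"
      using f(1) g(1) by (simp add: complex_vector.span_add)
    ultimately show ?thesis
      unfolding closure_sequential by (intro exI[of _ "\<lambda>n. f n + g n"] conjI)
  qed
  moreover have "c *\<^sub>C x \<in> closure ?V" if x: "x \<in> closure ?V" for c x
  proof -
    obtain f where f: "\<And>n::nat. f n \<in> ?V" "f \<longlonglongrightarrow> x"
      using x unfolding closure_sequential by blast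
    have "(\<lambda>n. c *\<^sub>C f n) \<longlonglongrightarrow> c *\<^sub>C x"
      using bounded_linear.tendsto[OF bounded_linear_scaleC f(2)] .
    moreover have "\<forall>n. c *\<^sub>C f n \<in> ?V"
      using f(1) by (simp add: complex_vector.span_scale)
    ultimately show ?thesis
      unfolding closure_sequential by (intro exI[of _ "\<lambda>n. c *\<^sub>C f n"] conjI)
  qed
  moreover have "0 \<in> closure ?V"
    using complex_vector.span_zero closure_subset by blast
  ultimately show ?thesis
    by (simp add: closed_csubspace_def closed_span_def complex_vector.subspace_def)
qed

section \<open>Contractive bilinear maps and closed ideals\<close>

lemma contractive_bilinear_flip:
  "contractive_bilinear f \<Longrightarrow> contractive_bilinear (\<lambda>x y. f y x)"
  unfolding contractive_bilinear_def by (simp add: mult.commute)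

lemma contractive_bilinear_mult:
  "contractive_bilinear ((*) :: 'a::complex_banach_algebra \<Rightarrow> 'a \<Rightarrow> 'a)"
  by unfold_locales
    (auto simp: distrib_left distrib_right mult_scaleC_left mult_scaleC_right norm_mult_ineq)

lemma (in contractive_bilinear) bounded_linear_right: "bounded_linear (f x)"
proof (rule bounded_linear_intro)
  fix y y' and r :: real
  show "f x (y + y') = f x y + f x y'"
    by (rule add_right)
  show "f x (r *\<^sub>R y) = r *\<^sub>R f x y"
    using scaleC_right[of x "complex_of_real r" y] by (simp add: scaleC_of_real)
  show "norm (f x y) \<le> norm y * norm x"
    using norm_le[of x y] by (simp add: mult.commute)
qed

lemma (in contractive_bilinear) closed_csubspace_vimage_right:
  assumes "closed_csubspace K"
  shows "closed_csubspace (f x -` K)"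
proof -
  interpret bounded_linear "f x"
    by (rule bounded_linear_right)
  have "closed (f x -` K)"
    using assms continuous_on[OF continuous_on_id]
    by (intro closed_vimage) (simp_all add: closed_csubspace_def)
  then show ?thesis
    using assms
    by (simp add: closed_csubspace_def complex_vector.subspace_def zero add_right scaleC_right)
qed

text \<open>The preimage of \<open>K\<close> under \<open>f x\<close> is again a closed subspace, so
  membership need only be checked on generators. Density arguments below rest on this and its
  left-hand version.\<close>

lemma (in contractive_bilinear) closed_span_right_mem:
  assumes "closed_csubspace K" "\<And>s. s \<in> S \<Longrightarrow> f x s \<in> K" "y \<in> closed_span S"
  shows "f x y \<in> K"
proof -
  have "closed_span S \<subseteq> f x -` K"
    using assms(2) by (intro closed_span_minimal closed_csubspace_vimage_right assms(1)) auto
  then show ?thesis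
    using assms(3) by auto
qed

lemma (in contractive_bilinear) closed_span_left_mem:
  assumes "closed_csubspace K" "\<And>s. s \<in> S \<Longrightarrow> f s y \<in> K" "x \<in> closed_span S"
  shows "f x y \<in> K"
  by (rule contractive_bilinear.closed_span_right_mem[OF
        contractive_bilinear_flip[OF contractive_bilinear_axioms] assms])

text \<open>Absorption passes from generators to limits of their combinations because multiplication
  is bilinear and continuous. Stability of \<open>S\<close> itself suits induced ideals, whose
  generators are pairing values.\<close>

lemma closed_ideal_closed_span:
  fixes S :: "'a::complex_banach_algebra set"
  assumes "\<And>a s. s \<in> S \<Longrightarrow> a * s \<in> S" "\<And>a s. s \<in> S \<Longrightarrow> s * a \<in> S"
  shows "closed_ideal (closed_span S)"
proof -
  note K = closed_csubspace_closed_span[of S]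
  have S: "s \<in> closed_span S" if "s \<in> S" for s
    using closed_span_superset that by (rule subsetD)
  have "a * x \<in> closed_span S" if "x \<in> closed_span S" for a x
    by (rule contractive_bilinear.closed_span_right_mem[OF contractive_bilinear_mult K _ that])
      (intro S assms(1))
  moreover have "x * a \<in> closed_span S" if "x \<in> closed_span S" for a x
    by (rule contractive_bilinear.closed_span_left_mem[OF contractive_bilinear_mult K _ that])
      (intro S assms(2))
  ultimately show ?thesis
    using K by (simp add: closed_ideal_def closed_csubspace_def)
qed

section \<open>Limits along approximate identities\<close>

context
  fixes \<Lambda> :: "'i set" and r :: "('i \<times> 'i) set" and u :: "'i \<Rightarrow> 'a::complex_banach_algebra"
  assumes bai: "bounded_approximate_identity \<Lambda> r u"
begin

text \<open>Reflexivity puts each index in its own tail, so no tail is empty. Without this,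
  convergence along the filter would say nothing about limits.\<close>

lemma tails_neq_bot: "tails \<Lambda> r \<noteq> bot"
proof -
  have d: "directed_on \<Lambda> r"
    using bai by (simp add: bounded_approximate_identity_def)
  then have "\<forall>i\<in>\<Lambda>. (i, i) \<in> r"
    by (simp add: directed_on_def preorder_on_def refl_on_def)
  then have "\<not> eventually (\<lambda>_. False) (tails \<Lambda> r)"
    unfolding eventually_tails[OF d] by blast
  then show ?thesis
    by (simp add: trivial_limit_def)
qed

text \<open>Since \<open>x\<close> is the limit of \<open>u i * x\<close>, an extra left factor can
  be cancelled in a closed set.\<close>

lemma mem_closed_if_left_multiples_mem:
  fixes x :: 'a
  assumes "closed K" "\<And>a. a * x \<in> K"
  shows "x \<in> K"
proof (rule Lim_in_closed_set[OF assms(1) _ tails_neq_bot])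
  show "((\<lambda>i. u i * x) \<longlongrightarrow> x) (tails \<Lambda> r)"
    using bai by (simp add: bounded_approximate_identity_def)
qed (simp add: assms(2))

lemma mem_closed_if_right_multiples_mem:
  fixes x :: 'a
  assumes "closed K" "\<And>a. x * a \<in> K"
  shows "x \<in> K"
proof (rule Lim_in_closed_set[OF assms(1) _ tails_neq_bot])
  show "((\<lambda>i. x * u i) \<longlongrightarrow> x) (tails \<Lambda> r)"
    using bai by (simp add: bounded_approximate_identity_def)
qed (simp add: assms(2))

end

section \<open>Induction of ideals along a Morita equivalence\<close>

lemma Ind_mono: "I \<subseteq> J \<Longrightarrow> Ind p q I \<subseteq> Ind p q J"
proof -
  assume "I \<subseteq> J"
  then have "ideal_submodule p I \<subseteq> ideal_submodule p J"
    unfolding ideal_submodule_def by blast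
  then show ?thesis
    unfolding Ind_def by (intro closed_span_mono) blast
qed

context morita_equivalence
begin

text \<open>Lets each result on induction from \<open>B\<close> to \<open>A\<close> be reused for
  induction from \<open>A\<close> to \<open>B\<close>.\<close>

lemma morita_equivalence_swap: "morita_equivalence lA rB lB rA pA pB"
  by unfold_locales
    \<comment> \<open>The rules follow the order of the locale axioms; the two associativity
      relations between pairings trade places and are read backwards.\<close>
    (rule pA_left, rule pA_right, rule pB_left, rule pB_right, rule pA_balanced,
      rule pB_balanced, rule rB_pB[symmetric], rule lB_pB[symmetric], rule pA_full, rule pB_full,
      rule lA_nondegenerate, rule rB_nondegenerate, rule lB_nondegenerate, rule rA_nondegenerate)

lemma closed_ideal_Ind:
  assumes "closed_ideal I"
  shows "closed_ideal (Ind pB pA I)"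
  unfolding Ind_def
proof (rule closed_ideal_closed_span)
  fix a s assume "s \<in> {pA x y | x y. x \<in> ideal_submodule pB I}"
  then obtain x y where s: "s = pA x y" and x: "\<And>z. pB z x \<in> I"
    by (auto simp: ideal_submodule_def)
  \<comment> \<open>Balancing moves \<open>a\<close> to the left argument, over which the condition
    on \<open>x\<close> quantifies. On the other side, \<open>s * a\<close> only alters the
    unconstrained argument \<open>y\<close>.\<close>
  have "pB z (lA a x) \<in> I" for z
    using x[of "rA z a"] by (simp add: pB_balanced)
  then show "a * s \<in> {pA x y | x y. x \<in> ideal_submodule pB I}"
    unfolding s pA_left[symmetric] by (auto simp: ideal_submodule_def)
  show "s * a \<in> {pA x y | x y. x \<in> ideal_submodule pB I}"
    unfolding s pA_right[symmetric] using x by (auto simp: ideal_submodule_def)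
qed

text \<open>On a generator \<open>pA y z\<close> of the induced ideal the value factors as
  \<open>pB e y * pB z x\<close>, whose first factor already lies in \<open>I\<close>; linearity and
  continuity of the action do the rest.\<close>

lemma pB_Ind_mem:
  assumes I: "closed_ideal I" and a: "a \<in> Ind pB pA I"
  shows "pB e (lA a x) \<in> I"
proof -
  have K: "closed_csubspace (pB e -` I)"
    by (intro pB.closed_csubspace_vimage_right closed_ideal_closed_csubspace I)
  have "lA a x \<in> pB e -` I"
    using a unfolding Ind_def
  proof (rule Er.left.closed_span_left_mem[OF K, rotated])
    fix s assume "s \<in> {pA x y | x y. x \<in> ideal_submodule pB I}"
    then obtain y z where s: "s = pA y z" and y: "pB e y \<in> I"
      by (auto simp: ideal_submodule_def)
    have "pB e (lA s x) = pB e y * pB z x"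
      unfolding s by (metis rB_pB pB_right)
    then show "lA s x \<in> pB e -` I"
      using I y by (simp add: closed_ideal_def)
  qed
  then show ?thesis
    by simp
qed

lemma Ind_Ind:
  fixes v :: "'j \<Rightarrow> 'b"
  assumes bai: "bounded_approximate_identity M r v" and I: "closed_ideal I"
  shows "Ind pA pB (Ind pB pA I) = I"
proof
  let ?J = "Ind pB pA I"
  have clI: "closed I"
    using I by (simp add: closed_ideal_def)
  show "Ind pA pB ?J \<subseteq> I"
    unfolding Ind_def[of pA pB]
  proof (rule closed_span_minimal[OF _ closed_ideal_closed_csubspace[OF I]], clarify)
    fix e x assume e: "e \<in> ideal_submodule pA ?J"
    show "pB e x \<in> I"
    proof (rule mem_closed_if_left_multiples_mem[OF bai clI])
      fix b
      \<comment> \<open>Fullness reduces an arbitrary multiplier \<open>b\<close> to pairing values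
        \<open>pB f y\<close>.\<close>
      have b: "b \<in> closed_span {pB e x | e x. True}"
        by (simp only: pB_full UNIV_I)
      show "b * pB e x \<in> I"
      proof (rule contractive_bilinear.closed_span_left_mem[OF contractive_bilinear_mult
            closed_ideal_closed_csubspace[OF I] _ b], clarify)
        fix f y
        \<comment> \<open>The factor \<open>pB f y\<close> first acts on \<open>e\<close>, becomes
          \<open>rA f (pA y e)\<close>, and then \<open>pA y e\<close> is moved across to
          \<open>x\<close>. The choice of \<open>e\<close> places \<open>pA y e\<close> in
          \<open>?J\<close>.\<close>
        have "pB f y * pB e x = pB f (lA (pA y e) x)"
          by (metis pB_left lB_pB pB_balanced)
        moreover have "pA y e \<in> ?J"
          using e by (simp add: ideal_submodule_def)
        ultimately show "pB f y * pB e x \<in> I"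
          using pB_Ind_mem[OF I] by simp
      qed
    qed
  qed
  show "I \<subseteq> Ind pA pB ?J"
  proof
    fix b assume b: "b \<in> I"
    have K: "closed_csubspace (Ind pA pB ?J)"
      unfolding Ind_def by (rule closed_csubspace_closed_span)
    show "b \<in> Ind pA pB ?J"
    proof (rule mem_closed_if_right_multiples_mem[OF bai])
      show "closed (Ind pA pB ?J)"
        using K by (simp add: closed_csubspace_def)
      fix c
      have c: "c \<in> closed_span {pB e x | e x. True}"
        by (simp only: pB_full UNIV_I)
      show "b * c \<in> Ind pA pB ?J"
      proof (rule contractive_bilinear.closed_span_right_mem[OF contractive_bilinear_mult K _ c],
          clarify)
        fix e x
        \<comment> \<open>Right multiplication by \<open>b\<close> sends all of the right module
          into the submodule of \<open>I\<close>. Balancing then shows that \<open>lB b e\<close>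
          lies in the submodule of \<open>?J\<close>, which makes \<open>b * pB e x\<close> a
          generator of the ideal induced back.\<close>
        have "rB y b \<in> ideal_submodule pB I" for y
          using I b by (simp add: ideal_submodule_def pB_right closed_ideal_def)
        then have "pA (rB y b) e \<in> ?J" for y
          unfolding Ind_def by (intro subsetD[OF closed_span_superset]) blast
        then have "lB b e \<in> ideal_submodule pA ?J"
          by (simp add: ideal_submodule_def pA_balanced)
        then show "b * pB e x \<in> Ind pA pB ?J"
          unfolding Ind_def[of pA pB] pB_left[symmetric]
          by (intro subsetD[OF closed_span_superset]) blast
      qed
    qed
  qed
qed

end

section \<open>Closed ideals as a complete lattice, and order isomorphisms\<close>

lemma carrier_ideal_lattice [simp]: "I \<in> carrier ideal_lattice \<longleftrightarrow> closed_ideal I"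
  by (simp add: ideal_lattice_def)

lemma le_ideal_lattice [simp]: "I \<sqsubseteq>\<^bsub>ideal_lattice\<^esub> J \<longleftrightarrow> I \<subseteq> J"
  by (simp add: ideal_lattice_def)

lemma closed_ideal_UNIV: "closed_ideal UNIV"
  by (simp add: closed_ideal_def)

lemma closed_ideal_Inter: "(\<And>I. I \<in> X \<Longrightarrow> closed_ideal I) \<Longrightarrow> closed_ideal (\<Inter>X)"
  unfolding closed_ideal_def by (auto intro!: complex_vector.subspace_Inter)

text \<open>Intersections serve as infima and the whole algebra as top element; suprema then exist
  without an explicit description.\<close>

lemma complete_lattice_ideal_lattice:
  "complete_lattice (ideal_lattice :: 'a::complex_banach_algebra set gorder)"
proof -
  interpret partial_order "ideal_lattice :: 'a set gorder"
    by unfold_locales (auto simp: ideal_lattice_def)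
  have "closed_ideal (UNIV :: 'a set)"
    by (rule closed_ideal_UNIV)
  then have "greatest ideal_lattice (UNIV :: 'a set) (carrier ideal_lattice)"
    by (simp add: greatest_def)
  moreover have "greatest ideal_lattice (\<Inter>X) (Lower ideal_lattice X)"
    if "X \<subseteq> carrier (ideal_lattice :: 'a set gorder)" for X
  proof (rule greatest_LowerI)
    have "closed_ideal I" if "I \<in> X" for I
      using \<open>X \<subseteq> _\<close> that by auto
    then show "\<Inter>X \<in> carrier ideal_lattice"
      by (simp add: closed_ideal_Inter)
    show "J \<sqsubseteq>\<^bsub>ideal_lattice\<^esub> \<Inter>X" if "J \<in> Lower ideal_lattice X" for J
      using Lower_memD[OF that _ \<open>X \<subseteq> _\<close>] by (simp add: Inter_greatest)
  qed (use that in auto)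
  ultimately show ?thesis
    by (intro complete_lattice_criterion1 exI)
qed

text \<open>Surjectivity gives a preimage \<open>s\<close> of the supremum of the image. As
  \<open>f\<close> reflects the order, \<open>s\<close> bounds \<open>A\<close> from above, which
  yields the inequality that monotonicity alone does not give.\<close>

lemma order_emb_sup_pres:
  assumes "complete_lattice L" "complete_lattice M" "order_emb L M f"
    and bij: "bij_betw f (carrier L) (carrier M)"
  shows "sup_pres L M f"
proof -
  interpret L: complete_lattice L by fact
  interpret M: complete_lattice M by fact
  have emb: "f x \<sqsubseteq>\<^bsub>M\<^esub> f y \<longleftrightarrow> x \<sqsubseteq>\<^bsub>L\<^esub> y" if "x \<in> carrier L" "y \<in> carrier L" for x y
    using assms(3) that by (simp add: order_emb_def)
  have fM: "f x \<in> carrier M" if "x \<in> carrier L" for x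
    using bij that by (rule bij_betw_apply)
  have "f (\<Squnion>\<^bsub>L\<^esub> A) = \<Squnion>\<^bsub>M\<^esub> (f ` A)" if A: "A \<subseteq> carrier L" for A
  proof (rule M.le_antisym)
    have fA: "f ` A \<subseteq> carrier M"
      using A fM by blast
    obtain s where s: "s \<in> carrier L" "f s = \<Squnion>\<^bsub>M\<^esub> (f ` A)"
      using bij M.sup_closed[OF fA] unfolding bij_betw_def by (metis imageE)
    have "x \<sqsubseteq>\<^bsub>L\<^esub> s" if "x \<in> A" for x
      using M.sup_upper[OF fA, of "f x"] that A s emb[of x s] by auto
    then have "\<Squnion>\<^bsub>L\<^esub> A \<sqsubseteq>\<^bsub>L\<^esub> s"
      using A s(1) by (intro L.sup_least) auto
    then show "f (\<Squnion>\<^bsub>L\<^esub> A) \<sqsubseteq>\<^bsub>M\<^esub> \<Squnion>\<^bsub>M\<^esub> (f ` A)"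
      using emb[OF L.sup_closed[OF A] s(1)] s(2) by simp
    show "\<Squnion>\<^bsub>M\<^esub> (f ` A) \<sqsubseteq>\<^bsub>M\<^esub> f (\<Squnion>\<^bsub>L\<^esub> A)"
      using A fA fM L.sup_closed[OF A] L.sup_upper[OF A]
      by (intro M.sup_least) (auto simp: emb subsetD)
    show "f (\<Squnion>\<^bsub>L\<^esub> A) \<in> carrier M" "\<Squnion>\<^bsub>M\<^esub> (f ` A) \<in> carrier M"
      using A fA fM by auto
  qed
  then show ?thesis
    using assms(1,2) by (simp add: sup_pres_def)
qed

text \<open>Dual argument: the preimage of the infimum of the image is a lower bound of
  \<open>A\<close>.\<close>

lemma order_emb_inf_pres:
  assumes "complete_lattice L" "complete_lattice M" "order_emb L M f"
    and bij: "bij_betw f (carrier L) (carrier M)"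
  shows "inf_pres L M f"
proof -
  interpret L: complete_lattice L by fact
  interpret M: complete_lattice M by fact
  have emb: "f x \<sqsubseteq>\<^bsub>M\<^esub> f y \<longleftrightarrow> x \<sqsubseteq>\<^bsub>L\<^esub> y" if "x \<in> carrier L" "y \<in> carrier L" for x y
    using assms(3) that by (simp add: order_emb_def)
  have fM: "f x \<in> carrier M" if "x \<in> carrier L" for x
    using bij that by (rule bij_betw_apply)
  have "f (\<Sqinter>\<^bsub>L\<^esub> A) = \<Sqinter>\<^bsub>M\<^esub> (f ` A)" if A: "A \<subseteq> carrier L" for A
  proof (rule M.le_antisym)
    have fA: "f ` A \<subseteq> carrier M"
      using A fM by blast
    obtain s where s: "s \<in> carrier L" "f s = \<Sqinter>\<^bsub>M\<^esub> (f ` A)"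
      using bij M.inf_closed[OF fA] unfolding bij_betw_def by (metis imageE)
    have "s \<sqsubseteq>\<^bsub>L\<^esub> x" if "x \<in> A" for x
      using M.inf_lower[OF fA, of "f x"] that A s emb[of s x] by auto
    then have "s \<sqsubseteq>\<^bsub>L\<^esub> \<Sqinter>\<^bsub>L\<^esub> A"
      using A s(1) by (intro L.inf_greatest) auto
    then show "\<Sqinter>\<^bsub>M\<^esub> (f ` A) \<sqsubseteq>\<^bsub>M\<^esub> f (\<Sqinter>\<^bsub>L\<^esub> A)"
      using emb[OF s(1) L.inf_closed[OF A]] s(2) by simp
    show "f (\<Sqinter>\<^bsub>L\<^esub> A) \<sqsubseteq>\<^bsub>M\<^esub> \<Sqinter>\<^bsub>M\<^esub> (f ` A)"
      using A fA fM L.inf_closed[OF A] L.inf_lower[OF A]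
      by (intro M.inf_greatest) (auto simp: emb subsetD)
    show "f (\<Sqinter>\<^bsub>L\<^esub> A) \<in> carrier M" "\<Sqinter>\<^bsub>M\<^esub> (f ` A) \<in> carrier M"
      using A fA fM by auto
  qed
  then show ?thesis
    using assms(1,2) by (simp add: inf_pres_def)
qed

theorem theorem2p9:
  fixes lB :: "'b::complex_banach_algebra \<Rightarrow> 'l::complex_banach \<Rightarrow> 'l"
    and rA :: "'l \<Rightarrow> 'a::complex_banach_algebra \<Rightarrow> 'l"
    and lA :: "'a \<Rightarrow> 'r::complex_banach \<Rightarrow> 'r"
    and rB :: "'r \<Rightarrow> 'b \<Rightarrow> 'r"
    and pB :: "'l \<Rightarrow> 'r \<Rightarrow> 'b"
    and pA :: "'r \<Rightarrow> 'l \<Rightarrow> 'a"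
    and \<Lambda> :: "'i set" and \<Lambda>_rel :: "('i \<times> 'i) set" and u :: "'i \<Rightarrow> 'a"
    and M :: "'j set" and M_rel :: "('j \<times> 'j) set" and v :: "'j \<Rightarrow> 'b"
  assumes bai_A: "bounded_approximate_identity \<Lambda> \<Lambda>_rel u"
    and bai_B: "bounded_approximate_identity M M_rel v"
    and morita: "morita_equivalence lB rA lA rB pB pA"
  shows
    "order_emb (ideal_lattice :: 'b set gorder) (ideal_lattice :: 'a set gorder) (Ind pB pA)
     \<and> bij_betw (Ind pB pA)
         (carrier (ideal_lattice :: 'b set gorder)) (carrier (ideal_lattice :: 'a set gorder))
     \<and> Ind pA pB \<in> carrier (ideal_lattice :: 'a set gorder)
         \<rightarrow> carrier (ideal_lattice :: 'b set gorder)
     \<and> (\<forall>I \<in> carrier (ideal_lattice :: 'b set gorder). Ind pA pB (Ind pB pA I) = I)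
     \<and> (\<forall>J \<in> carrier (ideal_lattice :: 'a set gorder). Ind pB pA (Ind pA pB J) = J)
     \<and> sup_pres (ideal_lattice :: 'b set gorder) (ideal_lattice :: 'a set gorder) (Ind pB pA)
     \<and> inf_pres (ideal_lattice :: 'b set gorder) (ideal_lattice :: 'a set gorder) (Ind pB pA)"
proof -
  let ?B = "ideal_lattice :: 'b set gorder" and ?A = "ideal_lattice :: 'a set gorder"
  note swap = morita_equivalence.morita_equivalence_swap[OF morita]
  note IndB = morita_equivalence.closed_ideal_Ind[OF morita]
    \<comment> \<open>\<open>IndA\<close> and \<open>BA\<close> come from the swapped equivalence,
      so \<open>BA\<close> cancels with the approximate identity of \<open>A\<close>.\<close>
    and IndA = morita_equivalence.closed_ideal_Ind[OF swap]
    and AB = morita_equivalence.Ind_Ind[OF morita bai_B]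
    and BA = morita_equivalence.Ind_Ind[OF swap bai_A]
  note latB = complete_lattice_ideal_lattice[where 'a = 'b]
    and latA = complete_lattice_ideal_lattice[where 'a = 'a]
  interpret B: complete_lattice ?B by (rule latB)
  interpret A: complete_lattice ?A by (rule latA)
  \<comment> \<open>Order is reflected by applying the monotone map \<open>Ind pA pB\<close> to both
    sides and cancelling with \<open>AB\<close>.\<close>
  have "Ind pB pA I \<subseteq> Ind pB pA I' \<longleftrightarrow> I \<subseteq> I'" if "closed_ideal I" "closed_ideal I'" for I I'
    using Ind_mono[of _ _ pB pA] Ind_mono[of _ _ pA pB] AB that by metis
  then have emb: "order_emb ?B ?A (Ind pB pA)"
    by (simp add: order_emb_def B.weak_partial_order_axioms A.weak_partial_order_axioms)
  have bij: "bij_betw (Ind pB pA) (carrier ?B) (carrier ?A)"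
    by (rule bij_betwI[where g = "Ind pA pB"]) (auto simp: IndA IndB AB BA)
  show ?thesis
    using emb bij order_emb_sup_pres[OF latB latA emb bij] order_emb_inf_pres[OF latB latA emb bij]
    by (simp add: IndA AB BA)
qed

end
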